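(* Let $\mathcal{A}\in\mathbb{R}^{n_1\times\cdots\times n_d}$ be an order-$d$ real tensor. Then $$\mathrm{rank}_{\otimes}(\mathbf{sym}(\mathcal{A}))\;\le\; d!\cdot\mathrm{rank}_{\otimes}(\mathcal{A}).$$
   Context: An order-$d$ tensor $\mathcal{A}\in\mathbb{R}^{n_1\times\cdots\times n_d}$ is a real $d$-dimensional array with entries $\mathcal{A}(i_1,\ldots,i_d)$, $1\le i_k\le n_k$. Outer product: for $t_k\in\mathbb{R}^{n_k}$, $t_1\circ\cdots\circ t_d\in\mathbb{R}^{n_1\times\cdots\times n_d}$ is the tensor with $(i_1,\ldots,i_d)$ entry $t_1(i_1)\cdots t_d(i_d)$. The outer product rank $\mathrm{rank}_{\otimes}(\mathcal{A})$ is the minimum $r$ such that $\mathcal{A}=\sum_{i=1}^r u_1^{(i)}\circ u_2^{(i)}\circ\cdots\circ u_d^{(i)}$ for some $u_j^{(i)}\in\mathbb{R}^{n_j}$. Transposition: for a permutation $\mathbf{p}=[p_1,\ldots,p_d]$ of $1,\ldots,d$, $\mathcal{A}^{<\mathbf{p}>}\in\mathbb{R}^{n_{p_1}\times\cdots\times n_{p_d}}$ is defined by $\mathcal{A}^{<\mathbf{p}>}(j_{p_1},\ldots,j_{p_d})=\mathcal{A}(j_1,\ldots,j_d)$ for $1\le j_k\le n_k$. Symmetric embedding: let $N=n_1+\cdots+n_d$ and partition the index range $1,\ldots,N$ into consecutive ranges $\mathbf{r}_1,\ldots,\mathbf{r}_d$ with $\mathbf{r}_k = (1+n_1+\cdots+n_{k-1}),\ldots,(n_1+\cdots+n_k)$.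 Then $\mathcal{C}=\mathbf{sym}(\mathcal{A})$ is the order-$d$ tensor in $\mathbb{R}^{N\times\cdots\times N}$ whose blocks $\mathcal{C}_{\mathbf{i}}=\mathcal{C}(\mathbf{r}_{i_1},\ldots,\mathbf{r}_{i_d})$, $1\le i_k\le d$, are $\mathcal{C}_{\mathbf{i}}=\mathcal{A}^{<\mathbf{i}>}$ if $\mathbf{i}=[i_1,\ldots,i_d]$ is a permutation of $1,\ldots,d$, and $\mathcal{C}_{\mathbf{i}}=0$ otherwise. *)

theory Defs
  imports Complex_Main "HOL-Library.FuncSet" "HOL-Combinatorics.Permutations"
begin

text \<open>
  An order-\<open>d\<close> real tensor of shape \<open>n 1 \<times> \<dots> \<times> n d\<close> is a function from multi-indices to
  the reals. Multi-indices are one-based functions \<open>i\<close> with \<open>1 \<le> i k \<le> n k\<close> for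
  \<open>1 \<le> k \<le> d\<close>, \<open>undefined\<close> at all other \<open>k\<close>; the values of a tensor off its index
  set are irrelevant to everything below.
\<close>

type_synonym tensor = "(nat \<Rightarrow> nat) \<Rightarrow> real"

definition tensor_index :: "nat \<Rightarrow> (nat \<Rightarrow> nat) \<Rightarrow> (nat \<Rightarrow> nat) set" where
  "tensor_index d n = (\<Pi>\<^sub>E k\<in>{1..d}. {1..n k})"

definition outer_product :: "nat \<Rightarrow> (nat \<Rightarrow> nat \<Rightarrow> real) \<Rightarrow> tensor" where
  "outer_product d t = (\<lambda>i. \<Prod>k=1..d. t k (i k))"

definition is_outer_decomposition ::
  "nat \<Rightarrow> (nat \<Rightarrow> nat) \<Rightarrow> tensor \<Rightarrow> nat \<Rightarrow> (nat \<Rightarrow> nat \<Rightarrow> nat \<Rightarrow> real) \<Rightarrow> bool" where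
  "is_outer_decomposition d n A r u \<longleftrightarrow>
     (\<forall>i\<in>tensor_index d n. A i = (\<Sum>s=1..r. outer_product d (u s) i))"

text \<open>
  The minimum is attained whenever \<open>d \<ge> 1\<close>; see \<open>tensor_rank_attained\<close>. For \<open>d = 0\<close> the
  empty outer product is 1, and most scalars have no decomposition.
\<close>

definition tensor_rank :: "nat \<Rightarrow> (nat \<Rightarrow> nat) \<Rightarrow> tensor \<Rightarrow> nat" where
  "tensor_rank d n A = (LEAST r. \<exists>u. is_outer_decomposition d n A r u)"

text \<open>
  If \<open>l = j \<circ> p\<close>, i.e. \<open>l = (j (p 1), \<dots>, j (p d))\<close>, then the transpose at \<open>l\<close> is
  \<open>A j = A (l \<circ> inv p)\<close>. Its shape is \<open>n \<circ> p\<close>.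
\<close>

definition tensor_transpose :: "(nat \<Rightarrow> nat) \<Rightarrow> tensor \<Rightarrow> tensor" where
  "tensor_transpose p A = (\<lambda>l. A (l \<circ> inv p))"

definition block_offset :: "(nat \<Rightarrow> nat) \<Rightarrow> nat \<Rightarrow> nat" where
  "block_offset n k = (\<Sum>m\<in>{1..<k}. n m)"

definition block_range :: "(nat \<Rightarrow> nat) \<Rightarrow> nat \<Rightarrow> nat set" where
  "block_range n k = {1 + block_offset n k .. block_offset n k + n k}"

definition block_of :: "nat \<Rightarrow> (nat \<Rightarrow> nat) \<Rightarrow> nat \<Rightarrow> nat" where
  "block_of d n x = (THE k. k \<in> {1..d} \<and> x \<in> block_range n k)"

text \<open>
  \<open>b\<close> is the multi-index of the block containing position \<open>J\<close>, extended by the identity so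
  that \<open>permutes\<close> applies, and \<open>l\<close> is the position of \<open>J\<close> inside that block.
\<close>

definition sym_embedding :: "nat \<Rightarrow> (nat \<Rightarrow> nat) \<Rightarrow> tensor \<Rightarrow> tensor" where
  "sym_embedding d n A = (\<lambda>J.
     let b = (\<lambda>k. if k \<in> {1..d} then block_of d n (J k) else k);
         l = (\<lambda>k\<in>{1..d}. J k - block_offset n (b k))
     in if b permutes {1..d} then tensor_transpose b A l else 0)"

lemma tensor_transpose_comp:
  assumes "p permutes {1..d}"
  shows "tensor_transpose p A (j \<circ> p) = A j"
  using permutes_inv_o(1)[OF assms] by (simp add: tensor_transpose_def comp_assoc)

lemma block_of_eq:
  assumes "k \<in> {1..d}" "x \<in> block_range n k"
  shows "block_of d n x = k"
proof -
  have mono: "block_offset n a + n a \<le> block_offset n c" if "1 \<le> a" "a < c" for a c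
  proof -
    have "block_offset n a + n a = (\<Sum>m\<in>{1..<Suc a}. n m)"
      using that by (simp add: block_offset_def)
    also have "\<dots> \<le> block_offset n c"
      unfolding block_offset_def using that by (intro sum_mono2) auto
    finally show ?thesis .
  qed
  have "c = k" if "c \<in> {1..d}" "x \<in> block_range n c" for c
    using mono[of c k] mono[of k c] that assms
    by (cases c k rule: linorder_cases) (auto simp: block_range_def)
  then show ?thesis
    unfolding block_of_def using assms by (blast intro: the_equality)
qed

lemma block_range_Union: "(\<Union>k\<in>{1..d}. block_range n k) = {1..\<Sum>k=1..d. n k}"
proof (induction d)
  case (Suc d)
  have "block_range n (Suc d) = {1 + (\<Sum>k=1..d. n k) .. (\<Sum>k=1..d. n k) + n (Suc d)}"
    by (simp add: block_range_def block_offset_def atLeastLessThanSuc_atLeastAtMost)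
  then show ?case
    using Suc by (auto simp: atLeastAtMostSuc_conv)
qed simp

lemma sym_embedding_block:
  assumes b: "b \<in> {1..d} \<rightarrow> {1..d}" "\<And>k. k \<notin> {1..d} \<Longrightarrow> b k = k"
    and l: "l \<in> tensor_index d (n \<circ> b)"
  shows "sym_embedding d n A (\<lambda>k\<in>{1..d}. block_offset n (b k) + l k) =
    (if b permutes {1..d} then tensor_transpose b A l else 0)"
proof -
  let ?J = "\<lambda>k\<in>{1..d}. block_offset n (b k) + l k"
  have "block_of d n (?J k) = b k" if "k \<in> {1..d}" for k
  proof -
    have "l k \<in> {1..n (b k)}"
      using l that by (auto simp: tensor_index_def PiE_iff)
    then show ?thesis
      using b that by (intro block_of_eq) (auto simp: block_range_def)
  qed
  then have 1: "(\<lambda>k. if k \<in> {1..d} then block_of d n (?J k) else k) = b"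
    using b(2) by (intro ext) (simp del: restrict_apply)
  have 2: "(\<lambda>k\<in>{1..d}. ?J k - block_offset n (b k)) = l"
    using l by (intro ext) (auto simp: tensor_index_def PiE_iff extensional_def)
  show ?thesis
    unfolding sym_embedding_def Let_def fun_cong[OF 1] 2 ..
qed

lemma tensor_rank_attained:
  assumes "1 \<le> d"
  shows "\<exists>u. is_outer_decomposition d n A (tensor_rank d n A) u"
proof -
  let ?I = "tensor_index d n"
  have fin: "finite ?I"
    by (auto simp: tensor_index_def intro!: finite_PiE)
  then obtain h where h: "bij_betw h {1..card ?I} ?I"
    using ex_bij_betw_nat_finite_1 by blast
  define u where
    "u s k x = (if x = h s k then 1 else 0) * (if k = 1 then A (h s) else 1)" for s k x
  have op: "outer_product d (u s) i = (if h s = i then A i else 0)"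
    if "i \<in> ?I" "s \<in> {1..card ?I}" for s i
  proof (cases "h s = i")
    case True
    then show ?thesis
      using assms by (simp add: outer_product_def u_def)
  next
    case False
    have "h s \<in> ?I" using h that by (auto simp: bij_betw_def)
    then have "\<exists>k\<in>{1..d}. i k \<noteq> h s k"
      using False that(1) unfolding tensor_index_def by (metis PiE_ext)
    then show ?thesis
      using False by (auto simp: outer_product_def u_def)
  qed
  have "A i = (\<Sum>s=1..card ?I. outer_product d (u s) i)" if i: "i \<in> ?I" for i
  proof -
    have "(\<Sum>s=1..card ?I. outer_product d (u s) i) =
        (\<Sum>s=1..card ?I. if h s = i then A i else 0)"
      using op i by (intro sum.cong) auto
    also have "\<dots> = (\<Sum>j\<in>?I. if j = i then A i else 0)"
      by (rule sum.reindex_bij_betw[OF h])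
    also have "\<dots> = A i" using fin i by simp
    finally show ?thesis by simp
  qed
  then have "\<exists>r u. is_outer_decomposition d n A r u"
    unfolding is_outer_decomposition_def by blast
  then show ?thesis
    unfolding tensor_rank_def by (rule LeastI_ex)
qed

end

(*
  Write A as a sum of r outer products of vectors u s 1, ..., u s d. For every permutation p
  and every s, place u s (p k) in the block p k of an otherwise zero vector, for each mode k.
  The outer product of these d vectors lives in the block [p 1, ..., p d] only, and the sum
  over s gives there the transpose of A by p. Summing also over p gives sym(A) with d! * r terms.
*)
theory Submission
  imports Defs
begin

text \<open>Enumerating \<open>S\<close> turns a sum over any finite set into one over
  \<open>{1..card S}\<close>, so terms may be indexed by pairs of a permutation and a
  summand.\<close>

lemma tensor_rank_le_card:
  assumes "finite S"
    and "\<And>i. i \<in> tensor_index d n \<Longrightarrow> A i = (\<Sum>a\<in>S. outer_product d (w a) i)"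
  shows "tensor_rank d n A \<le> card S"
proof -
  obtain h where h: "bij_betw h {1..card S} S"
    using ex_bij_betw_nat_finite_1[OF assms(1)] by blast
  have "is_outer_decomposition d n A (card S) (w \<circ> h)"
    using assms(2) sum.reindex_bij_betw[OF h, of "\<lambda>a. outer_product d (w a) i" for i]
    by (simp add: is_outer_decomposition_def)
  then show ?thesis
    unfolding tensor_rank_def by (blast intro: Least_le)
qed

lemma block_of_mem:
  assumes "x \<in> {1..\<Sum>k=1..d. n k}"
  shows "block_of d n x \<in> {1..d}" "x \<in> block_range n (block_of d n x)"
proof -
  obtain k where "k \<in> {1..d}" "x \<in> block_range n k"
    using assms unfolding block_range_Union[symmetric] by blast
  then show "block_of d n x \<in> {1..d}" "x \<in> block_range n (block_of d n x)"
    using block_of_eq by auto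
qed

lemma tensor_index_comp_inv:
  assumes "p permutes {1..d}" "l \<in> tensor_index d (n \<circ> p)"
  shows "l \<circ> inv p \<in> tensor_index d n"
proof -
  have "l (inv p k) \<in> {1..n k}" if "k \<in> {1..d}" for k
  proof -
    have "inv p k \<in> {1..d}"
      using permutes_in_image[OF permutes_inv[OF assms(1)]] that by blast
    then have "l (inv p k) \<in> {1..n (p (inv p k))}"
      using assms(2) by (auto simp: tensor_index_def PiE_iff)
    then show ?thesis
      by (simp add: permutes_inverses(1)[OF assms(1)])
  qed
  \<comment> \<open>\<open>inv p\<close> fixes every point outside \<open>{1..d}\<close>, so
    extensionality survives the composition.\<close>
  moreover have "l (inv p k) = undefined" if "k \<notin> {1..d}" for k
    using assms(2) that permutes_not_in[OF permutes_inv[OF assms(1)] that]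
    by (auto simp: tensor_index_def PiE_iff extensional_def)
  ultimately show ?thesis
    by (auto simp: tensor_index_def PiE_iff extensional_def)
qed

text \<open>Reindexing the product along \<open>p\<close> cancels \<open>inv p\<close> in the
  argument and moves \<open>p\<close> onto the factors.\<close>

lemma outer_product_comp_inv:
  assumes "p permutes {1..d}"
  shows "outer_product d t (l \<circ> inv p) = outer_product d (t \<circ> p) l"
proof -
  have "outer_product d t (l \<circ> inv p) = (\<Prod>k=1..d. t (p k) ((l \<circ> inv p) (p k)))"
    unfolding outer_product_def
    using prod.permute[OF assms, of "\<lambda>k. t k ((l \<circ> inv p) k)"] by (simp add: o_def)
  then show ?thesis
    by (simp add: outer_product_def permutes_inverses(2)[OF assms])
qed

text \<open>Each \<open>J\<close> lies in exactly one block \<open>b\<close>, and the terms of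
  \<open>p\<close> vanish there unless \<open>p = b\<close>. So at most one permutation contributes,
  and none does when \<open>b\<close> is not a permutation.\<close>

lemma sym_embedding_eq_sum:
  assumes u: "is_outer_decomposition d n A r u"
    and J: "J \<in> tensor_index d (\<lambda>_. \<Sum>k=1..d. n k)"
  defines "w \<equiv> \<lambda>p s k x. if block_of d n x = p k then u s (p k) (x - block_offset n (p k)) else 0"
  shows "sym_embedding d n A J =
    (\<Sum>p\<in>{p. p permutes {1..d}}. \<Sum>s=1..r. outer_product d (w p s) J)"
proof -
  define b where "b = (\<lambda>k. if k \<in> {1..d} then block_of d n (J k) else k)"
  define l where "l = (\<lambda>k\<in>{1..d}. J k - block_offset n (b k))"
  have Jk: "J k \<in> {1..\<Sum>k=1..d. n k}" if "k \<in> {1..d}" for k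
    using J that unfolding tensor_index_def by (rule PiE_mem)
  \<comment> \<open>A block starts at offset plus one, so the subtraction on naturals in
    \<open>l\<close> never truncates and the result is at least 1.\<close>
  have "l k \<in> {1..n (b k)}" if "k \<in> {1..d}" for k
    using block_of_mem(2)[OF Jk[OF that]] that by (auto simp: l_def b_def block_range_def)
  then have l: "l \<in> tensor_index d (n \<circ> b)"
    by (auto simp: tensor_index_def PiE_iff l_def)
  have w: "outer_product d (w p s) J = (if b = p then outer_product d (u s \<circ> b) l else 0)"
    if p: "p permutes {1..d}" for p s
  proof (cases "b = p")
    case True
    then show ?thesis
      by (auto simp: outer_product_def w_def l_def b_def intro!: prod.cong)
  next
    case False
    \<comment> \<open>Both maps are the identity off \<open>{1..d}\<close>, so they differ at some
      mode; the factor of that mode is zero.\<close>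
    have "\<exists>k\<in>{1..d}. b k \<noteq> p k"
    proof (rule ccontr)
      assume *: "\<not> ?thesis"
      have "b k = p k" for k
        using * permutes_not_in[OF p, of k] by (cases "k \<in> {1..d}") (auto simp: b_def)
      then show False using False by blast
    qed
    then have "\<exists>k\<in>{1..d}. w p s k (J k) = 0"
      by (auto simp: w_def b_def)
    then show ?thesis
      using False by (auto simp: outer_product_def)
  qed
  have "sym_embedding d n A J = (if b permutes {1..d} then A (l \<circ> inv b) else 0)"
    unfolding sym_embedding_def Let_def tensor_transpose_def b_def l_def ..
  \<comment> \<open>The decomposition of \<open>A\<close> holds only on its index set, which
    contains \<open>l \<circ> inv b\<close> when \<open>b\<close> is a permutation.\<close>
  also have "\<dots> = (if b permutes {1..d} then \<Sum>s=1..r. outer_product d (u s \<circ> b) l else 0)"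
    using u tensor_index_comp_inv[OF _ l]
    by (simp add: is_outer_decomposition_def outer_product_comp_inv)
  \<comment> \<open>The case distinction becomes a delta sum: \<open>b permutes {1..d}\<close> says
    that \<open>b\<close> is in the summation set.\<close>
  also have "\<dots> = (\<Sum>p\<in>{p. p permutes {1..d}}.
      if b = p then \<Sum>s=1..r. outer_product d (u s \<circ> b) l else 0)"
    by (simp add: finite_permutations)
  also have "\<dots> = (\<Sum>p\<in>{p. p permutes {1..d}}. \<Sum>s=1..r. outer_product d (w p s) J)"
    by (intro sum.cong) (auto simp: w)
  finally show ?thesis .
qed

theorem mainTheorem6:
  fixes d :: nat and n :: "nat \<Rightarrow> nat" and A :: tensor
  assumes "1 \<le> d"
  shows "tensor_rank d (\<lambda>_. \<Sum>k=1..d. n k) (sym_embedding d n A) \<le> fact d * tensor_rank d n A"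
proof -
  let ?P = "{p. p permutes {1..d}}" and ?r = "tensor_rank d n A"
  obtain u where u: "is_outer_decomposition d n A ?r u"
    using tensor_rank_attained[OF assms] by blast
  have "tensor_rank d (\<lambda>_. \<Sum>k=1..d. n k) (sym_embedding d n A) \<le> card (?P \<times> {1..?r})"
    by (rule tensor_rank_le_card)
      (simp_all add: finite_permutations sym_embedding_eq_sum[OF u] sum.cartesian_product
        case_prod_unfold)
  also have "\<dots> = fact d * ?r"
    by (simp add: card_cartesian_product card_permutations[OF refl])
  finally show ?thesis .
qed

end
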